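(* Let $A$ be an $m\times n$ matrix with entries in $\mathbb{R}\cup\{-\infty\}$. Then the maximal row rank of $A$, the maximal column rank of $A$ and the tropical rank of $A$ coincide.
   Context: Write $[n]=\{1,\dots,n\}$. The columns of a $p\times q$ matrix $C$ with entries in $\mathbb{R}\cup\{-\infty\}$ are tropically linearly dependent if there exist $x_1,\dots,x_q\in\mathbb{R}\cup\{-\infty\}$, not all $-\infty$, such that for every $i\in[p]$ the maximum in $\max_{j\in[q]}(C_{ij}+x_j)$ is attained by at least two values of $j$ or is equal to $-\infty$; they are tropically linearly independent otherwise. Rows are tropically linearly (in)dependent if they are so as columns of the transpose matrix. The maximal row (resp. column) rank of $A$ is the maximal number of tropically linearly independent rows (resp. columns) of $A$. A $k\times k$ matrix $B$ with entries in $\mathbb{R}\cup\{-\infty\}$ is tropically singular if the maximum $\max_\sigma\sum_{i\in[k]}B_{i\sigma(i)}$ over all permutations $\sigma$ of $[k]$ is attained by at least two permutations or is equal to $-\infty$; it is tropically nonsingular otherwise. The tropical rank of $A$ is the maximal size $k$ of a tropically nonsingular $k\times k$ submatrix of $A$ (with arbitrary choice of $k$ rows and $k$ columns). *)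

theory Defs
  imports
    "HOL-Library.Extended_Real"
    "HOL-Combinatorics.Permutations"
    "Jordan_Normal_Form.DL_Submatrix"
begin

text \<open>
  The tropical (max-plus) semiring consists of the real numbers and $-\infty$. It is carried by the
  extended reals other than \<^term>\<open>\<infinity> :: ereal\<close>; the definitions below are meant for matrices whose
  entries lie in this set. Rows and columns of matrices are indexed from \<open>0\<close>.
\<close>

definition trop_scalars :: "ereal set"
  where "trop_scalars = {a. a \<noteq> \<infinity>}"

definition trop_cols_dependent :: "ereal mat \<Rightarrow> bool"
  where "trop_cols_dependent C \<longleftrightarrow>
    (\<exists>x. (\<forall>j<dim_col C. x j \<in> trop_scalars) \<and>
         (\<exists>j<dim_col C. x j \<noteq> -\<infinity>) \<and>
         (\<forall>i<dim_row C.
            let M = Max ((\<lambda>j. C $$ (i, j) + x j) ` {..<dim_col C})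
            in 2 \<le> card {j. j < dim_col C \<and> C $$ (i, j) + x j = M} \<or> M = -\<infinity>))"

definition trop_rows_dependent :: "ereal mat \<Rightarrow> bool"
  where "trop_rows_dependent C \<longleftrightarrow> trop_cols_dependent (transpose_mat C)"

text \<open>
  Linear independence of some of the columns of \<open>A\<close> is that of the family of columns with index
  in \<open>J\<close>, so that equal columns at different positions are counted separately (and are dependent).
  The empty family is independent, whence the sets of sizes below contain \<open>0\<close>.
\<close>

definition max_col_rank :: "ereal mat \<Rightarrow> nat"
  where "max_col_rank A =
    Max {card J | J. J \<subseteq> {..<dim_col A} \<and>
                     \<not> trop_cols_dependent (submatrix A {..<dim_row A} J)}"

definition max_row_rank :: "ereal mat \<Rightarrow> nat"
  where "max_row_rank A =
    Max {card I | I. I \<subseteq> {..<dim_row A} \<and>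
                     \<not> trop_rows_dependent (submatrix A I {..<dim_col A})}"

definition trop_perm_weight :: "ereal mat \<Rightarrow> (nat \<Rightarrow> nat) \<Rightarrow> ereal"
  where "trop_perm_weight B \<sigma> = (\<Sum>i<dim_row B. B $$ (i, \<sigma> i))"

text \<open>The following notion is meant for square matrices.\<close>

definition trop_singular :: "ereal mat \<Rightarrow> bool"
  where "trop_singular B \<longleftrightarrow>
    (let P = {\<sigma>. \<sigma> permutes {..<dim_row B}};
         M = Max (trop_perm_weight B ` P)
     in 2 \<le> card {\<sigma> \<in> P. trop_perm_weight B \<sigma> = M} \<or> M = -\<infinity>)"

text \<open>The empty matrix (\<open>k = 0\<close>) is nonsingular, so a matrix without finite entries has rank \<open>0\<close>.\<close>

definition trop_rank :: "ereal mat \<Rightarrow> nat"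
  where "trop_rank A =
    Max {k. \<exists>I J. I \<subseteq> {..<dim_row A} \<and> J \<subseteq> {..<dim_col A} \<and> card I = k \<and> card J = k \<and>
                  \<not> trop_singular (submatrix A I J)}"

end

theory Submission imports Defs begin

text \<open>
  Everything reduces to one equivalence: the columns of a matrix \<open>C\<close> with \<open>k\<close> columns are
  independent if and only if \<open>C\<close> has a nonsingular \<open>k\<close>-by-\<open>k\<close> submatrix. It says that the sizes of
  independent column sets are exactly the sizes of nonsingular submatrices, so the maximal column
  rank is the tropical rank; a permutation and its inverse show that the tropical rank is invariant
  under transposition, which gives the row rank.

  If the columns of a square matrix satisfy a dependence \<open>x\<close> and \<open>\<sigma>\<close> is a permutation of finite
  weight, then in the row that \<open>\<sigma>\<close> matches with a column \<open>j\<close> of the support of \<open>x\<close> another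
  column \<open>f j\<close> of the support does at least as well as \<open>j\<close>. The fixed-point free map \<open>f\<close> permutes
  some nonempty set of columns. Composing \<open>\<sigma>\<close> with this permutation makes the weight no smaller, as
  the contributions of \<open>x\<close> cancel. Hence no permutation is a unique optimum (\<open>singular_if_balanced\<close>).

  The converse rests on an alternative (\<open>balanced_or_dominating\<close>): either the columns are dependent,
  or there are real numbers \<open>v j\<close> such that, once \<open>v j\<close> is added to each column \<open>j\<close>, every column
  holds the strict maximum of some row. In the second case different columns have different such
  rows, and these rows form a square submatrix in which choosing the row maxima is the unique
  optimal permutation (\<open>nonsingular_if_dominating\<close>).

  To prove the alternative, start with the zero vector and repeatedly lower every coordinate \<open>j\<close>
  until \<open>C i j + x j\<close> is in no row a strict maximum, but by at most one in each step. This operation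
  is monotone and commutes with adding constants. If some coordinates stay bounded, their limits,
  together with \<open>-\<infinity>\<close> in the other coordinates, form a dependence. Otherwise all coordinates are
  below \<open>-1\<close> after some number \<open>k\<close> of steps, and the minimum of the first \<open>k\<close> iterates, the \<open>l\<close>-th
  one raised by \<open>l / k\<close>, is lowered strictly in every coordinate. A column whose coordinate is
  lowered strictly held the strict maximum of some row, so this minimum is the vector \<open>v\<close>.
\<close>

section \<open>Maxima that are attained twice\<close>

text \<open>
  Dependence and singularity both ask for a maximum that is attained twice or equals \<open>-\<infinity>\<close>. Stated
  through a competitor for each finite value, the condition avoids the maximum and can be passed on
  to subfamilies and through bijections.
\<close>

lemma max_attained_twice_iff:
  fixes f :: "'a \<Rightarrow> ereal"
  assumes "finite P" "P \<noteq> {}"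
  shows "2 \<le> card {p \<in> P. f p = Max (f ` P)} \<or> Max (f ` P) = -\<infinity> \<longleftrightarrow>
    (\<forall>p\<in>P. f p \<noteq> -\<infinity> \<longrightarrow> (\<exists>q\<in>P. q \<noteq> p \<and> f p \<le> f q))"
    (is "?L \<longleftrightarrow> ?R")
proof
  assume L: ?L
  show ?R
  proof (intro ballI impI)
    fix p assume p: "p \<in> P" "f p \<noteq> -\<infinity>"
    have le: "f p \<le> Max (f ` P)" using assms p by auto
    then have "Max (f ` P) \<noteq> -\<infinity>" using p by auto
    with L have c: "2 \<le> card {p \<in> P. f p = Max (f ` P)}" by simp
    have "\<not> {p \<in> P. f p = Max (f ` P)} \<subseteq> {p}"
      using c card_mono[of "{p}" "{p \<in> P. f p = Max (f ` P)}"] by auto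
    then show "\<exists>q\<in>P. q \<noteq> p \<and> f p \<le> f q" using le by auto
  qed
next
  assume R: ?R
  have "Max (f ` P) \<in> f ` P" using assms by (intro Max_in) auto
  then obtain p where p: "p \<in> P" "f p = Max (f ` P)" by force
  show ?L
  proof (cases "Max (f ` P) = -\<infinity>")
    case False
    with R p obtain q where q: "q \<in> P" "q \<noteq> p" "f p \<le> f q" by metis
    have "f q \<le> Max (f ` P)" using assms q by auto
    then have "{p, q} \<subseteq> {p \<in> P. f p = Max (f ` P)}" using p q by auto
    from card_mono[OF _ this] show ?thesis using q assms by auto
  qed simp
qed

definition balanced :: "('r \<Rightarrow> 'c \<Rightarrow> ereal) \<Rightarrow> 'r set \<Rightarrow> 'c set \<Rightarrow> ('c \<Rightarrow> ereal) \<Rightarrow> bool"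
  where "balanced C R J x \<longleftrightarrow>
    (\<forall>i\<in>R. \<forall>j\<in>J. C i j + x j \<noteq> -\<infinity> \<longrightarrow> (\<exists>l\<in>J. l \<noteq> j \<and> C i j + x j \<le> C i l + x l))"

lemma trop_cols_dependent_iff:
  "trop_cols_dependent C \<longleftrightarrow>
    (\<exists>x. (\<forall>j<dim_col C. x j \<noteq> \<infinity>) \<and> (\<exists>j<dim_col C. x j \<noteq> -\<infinity>) \<and>
      balanced (\<lambda>i j. C $$ (i, j)) {..<dim_row C} {..<dim_col C} x)"
proof -
  have *: "(let M = Max ((\<lambda>j. C $$ (i, j) + x j) ` {..<dim_col C})
            in 2 \<le> card {j. j < dim_col C \<and> C $$ (i, j) + x j = M} \<or> M = -\<infinity>) \<longleftrightarrow>
     (\<forall>j\<in>{..<dim_col C}. C $$ (i, j) + x j \<noteq> -\<infinity> \<longrightarrow>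
        (\<exists>l\<in>{..<dim_col C}. l \<noteq> j \<and> C $$ (i, j) + x j \<le> C $$ (i, l) + x l))"
    if "\<exists>j<dim_col C. x j \<noteq> -\<infinity>" for x i
    using max_attained_twice_iff[of "{..<dim_col C}" "\<lambda>j. C $$ (i, j) + x j"] that
    by (auto simp: Let_def)
  show ?thesis
    unfolding trop_cols_dependent_def balanced_def trop_scalars_def
    by (intro ex_cong1 conj_cong refl) (simp_all only: * mem_Collect_eq, auto)
qed

lemma trop_singular_iff:
  "trop_singular B \<longleftrightarrow>
    (\<forall>\<sigma>. \<sigma> permutes {..<dim_row B} \<longrightarrow> trop_perm_weight B \<sigma> \<noteq> -\<infinity> \<longrightarrow>
      (\<exists>\<tau>. \<tau> permutes {..<dim_row B} \<and> \<tau> \<noteq> \<sigma> \<and> trop_perm_weight B \<sigma> \<le> trop_perm_weight B \<tau>))"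
proof -
  have "{\<sigma>. \<sigma> permutes {..<dim_row B}} \<noteq> {}" using permutes_id by blast
  from max_attained_twice_iff[OF finite_permutations[OF finite_lessThan] this, of "trop_perm_weight B"]
  show ?thesis unfolding trop_singular_def Let_def by simp
qed

section \<open>Dependence or dominating scalings\<close>

text \<open>
  The inner maximum over \<open>l\<close> is the value of \<open>x j\<close> at which column \<open>j\<close> ties with the best other column
  in row \<open>i\<close>. Capping it below by \<open>x j - 1\<close> keeps the result real even if column \<open>j\<close> has the only
  finite entry of the row, where the tie would be at \<open>-\<infinity>\<close>.
\<close>
definition lowered :: "('r \<Rightarrow> 'c \<Rightarrow> ereal) \<Rightarrow> 'r set \<Rightarrow> 'c set \<Rightarrow> ('c \<Rightarrow> real) \<Rightarrow> 'c \<Rightarrow> real"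
  where "lowered C R J x j = Min (insert (x j)
    ((\<lambda>i. Max (insert (x j - 1)
        ((\<lambda>l. real_of_ereal (C i l) - real_of_ereal (C i j) + x l) ` {l \<in> J. l \<noteq> j \<and> C i l \<noteq> -\<infinity>})))
      ` {i \<in> R. C i j \<noteq> -\<infinity>}))"

lemma lowered_le_iff:
  assumes "finite R" "finite J"
  shows "lowered C R J x j \<le> a \<longleftrightarrow> x j \<le> a \<or>
    (\<exists>i\<in>R. C i j \<noteq> -\<infinity> \<and> x j - 1 \<le> a \<and>
      (\<forall>l\<in>J. l \<noteq> j \<longrightarrow> C i l \<noteq> -\<infinity> \<longrightarrow> real_of_ereal (C i l) - real_of_ereal (C i j) + x l \<le> a))"
  unfolding lowered_def using assms by (subst Min_le_iff; simp) blast

text \<open>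
  Monotonicity and compatibility with the addition of constants in one statement. This is what
  makes bounds on the iterates of \<open>lowered\<close> carry over to minima of shifted iterates.
\<close>
lemma lowered_mono_shift:
  assumes "finite R" "finite J" "j \<in> J" "\<And>l. l \<in> J \<Longrightarrow> x l \<le> y l + d"
  shows "lowered C R J x j \<le> lowered C R J y j + d"
proof -
  have "lowered C R J y j \<le> lowered C R J y j" by simp
  then show ?thesis
    unfolding lowered_le_iff[OF assms(1,2)]
    using assms(4)[OF assms(3)] assms(4) by (force simp: algebra_simps)
qed

lemma lowered_le_self:
  assumes "finite R" "finite J"
  shows "lowered C R J x j \<le> x j"
  by (simp add: lowered_le_iff[OF assms])

lemma common_index:
  fixes s :: "nat \<Rightarrow> 'c \<Rightarrow> real"
  assumes "finite L" and "\<And>l. decseq (\<lambda>k. s k l)" and "\<And>l. l \<in> L \<Longrightarrow> \<exists>k. s k l < b l"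
  shows "\<exists>k\<ge>K. \<forall>l\<in>L. s k l < b l"
proof -
  from assms(3) obtain f where f: "\<And>l. l \<in> L \<Longrightarrow> s (f l) l < b l" by metis
  let ?k = "Max (insert K (f ` L))"
  have "s ?k l < b l" if "l \<in> L" for l
  proof -
    have "f l \<le> ?k" using that assms(1) by auto
    then show ?thesis using f[OF that] decseqD[OF assms(2), of "f l" ?k l] by simp
  qed
  moreover have "K \<le> ?k" using assms(1) by auto
  ultimately show ?thesis by blast
qed

text \<open>
  A coordinate decreases only because of some row in which all other columns stay strictly behind.
\<close>
lemma dominating_scaling:
  assumes fin: "finite R" "finite J" and C: "\<And>i j. i \<in> R \<Longrightarrow> j \<in> J \<Longrightarrow> C i j \<noteq> \<infinity>"
    and drop: "\<And>j. j \<in> J \<Longrightarrow> lowered C R J v j < v j"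
  shows "\<forall>j\<in>J. \<exists>i\<in>R. C i j \<noteq> -\<infinity> \<and>
    (\<forall>l\<in>J. l \<noteq> j \<longrightarrow> C i l + ereal (v l) < C i j + ereal (v j))"
proof
  fix j assume j: "j \<in> J"
  have "lowered C R J v j \<le> lowered C R J v j" by simp
  then obtain i where i: "i \<in> R" "C i j \<noteq> -\<infinity>" and
    l: "\<And>l. l \<in> J \<Longrightarrow> l \<noteq> j \<Longrightarrow> C i l \<noteq> -\<infinity> \<Longrightarrow>
        real_of_ereal (C i l) - real_of_ereal (C i j) + v l \<le> lowered C R J v j"
    unfolding lowered_le_iff[OF fin] using drop[OF j] by fastforce
  have "C i l + ereal (v l) < C i j + ereal (v j)" if "l \<in> J" "l \<noteq> j" for l
    using l[OF that] drop[OF j] C[OF i(1) j] C[OF i(1) that(1)] i(2)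
    by (cases "C i l"; cases "C i j") auto
  with i show "\<exists>i\<in>R. C i j \<noteq> -\<infinity> \<and>
    (\<forall>l\<in>J. l \<noteq> j \<longrightarrow> C i l + ereal (v l) < C i j + ereal (v j))" by blast
qed

text \<open>
  The dichotomy depends on whether the iterates of \<open>lowered\<close> stay bounded below in some coordinate.
\<close>
lemma balanced_or_dominating:
  fixes C :: "'r \<Rightarrow> 'c \<Rightarrow> ereal"
  assumes fin: "finite R" "finite J" and C: "\<And>i j. i \<in> R \<Longrightarrow> j \<in> J \<Longrightarrow> C i j \<noteq> \<infinity>"
  shows "(\<exists>x. (\<forall>j\<in>J. x j \<noteq> \<infinity>) \<and> (\<exists>j\<in>J. x j \<noteq> -\<infinity>) \<and> balanced C R J x) \<or>
    (\<exists>v. \<forall>j\<in>J. \<exists>i\<in>R. C i j \<noteq> -\<infinity> \<and>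
      (\<forall>l\<in>J. l \<noteq> j \<longrightarrow> C i l + ereal (v l) < C i j + ereal (v j)))"
proof -
  define s where "s k = (lowered C R J ^^ k) (\<lambda>_. 0)" for k
  have s_Suc: "s (Suc k) = lowered C R J (s k)" for k by (simp add: s_def)
  have dec: "decseq (\<lambda>k. s k j)" for j
    by (intro decseq_SucI) (simp add: s_Suc lowered_le_self[OF fin])
  define S where "S = {j \<in> J. bdd_below (range (\<lambda>k. s k j))}"
  define X where "X j = (INF k. s k j)" for j
  have X_le: "X j \<le> s k j" if "j \<in> S" for j k
    using that unfolding S_def X_def by (auto intro: cINF_lower)
  show ?thesis
  proof (cases "S = {}")
    case False
    \<comment> \<open>the limit of the iterates: they decrease, so their infimum is the limit\<close>
    define x where "x j = (if j \<in> S then ereal (X j) else -\<infinity>)" for j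
    have "balanced C R J x"
      unfolding balanced_def
    proof (intro ballI impI)
      fix i j assume ij: "i \<in> R" "j \<in> J" and nz: "C i j + x j \<noteq> -\<infinity>"
      have j: "j \<in> S" and Cj: "C i j \<noteq> -\<infinity>" using nz C[OF ij] by (auto simp: x_def split: if_splits)
      define L where "L = {l \<in> J. l \<noteq> j \<and> C i l \<noteq> -\<infinity>}"
      let ?g = "\<lambda>l. real_of_ereal (C i l) - real_of_ereal (C i j)"
      \<comment> \<open>If every other column falls behind the limit \<open>X j\<close>, then all do so in one late step, in which
        \<open>s k j\<close> is also within one of its limit; the next step then takes coordinate \<open>j\<close> below \<open>X j\<close>.\<close>
      have "\<exists>l\<in>L. \<forall>k. X j \<le> ?g l + s k l"
      proof (rule ccontr)
        assume "\<not> ?thesis"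
        then have ex: "\<exists>k. s k l < X j - ?g l" if "l \<in> L" for l
          using that by (auto simp: not_le algebra_simps)
        have "\<exists>k. s k j < X j + 1"
          using cInf_lessD[of "range (\<lambda>k. s k j)" "X j + 1"] by (auto simp: X_def)
        then obtain K where K: "s K j < X j + 1" by blast
        obtain k where k: "k \<ge> K" "\<forall>l\<in>L. s k l < X j - ?g l"
          using common_index[of L s "\<lambda>l. X j - ?g l" K] dec ex fin by (auto simp: L_def)
        have "s k j < X j + 1" using decseqD[OF dec k(1), of j] K by simp
        then obtain a where a: "a < X j" "s k j - 1 \<le> a" "\<And>l. l \<in> L \<Longrightarrow> ?g l + s k l \<le> a"
        proof -
          let ?a = "Max (insert (s k j - 1) ((\<lambda>l. ?g l + s k l) ` L))"
          have fL: "finite L" using fin by (simp add: L_def)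
          show ?thesis
          proof (rule that[of ?a])
            show "?a < X j" using fL k(2) \<open>s k j < X j + 1\<close>
              by (subst Max_less_iff) (auto simp: algebra_simps)
          qed (use fL in auto)
        qed
        have "s (Suc k) j \<le> a"
          unfolding s_Suc lowered_le_iff[OF fin] using ij Cj a(2,3) by (auto simp: L_def)
        with X_le[OF j, of "Suc k"] a(1) show False by simp
      qed
      then obtain l where l: "l \<in> L" and ge: "\<And>k. X j \<le> ?g l + s k l" by blast
      have ge': "X j - ?g l \<le> s k l" for k using ge[of k] by simp
      have lS: "l \<in> S" using l ge' unfolding S_def L_def by (auto intro!: bdd_belowI2)
      have "X j - ?g l \<le> X l" unfolding X_def[of l] using ge' by (auto intro: cINF_greatest)
      then have "C i j + x j \<le> C i l + x l"
        using j lS Cj l C[OF ij] C[OF ij(1), of l]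
        by (cases "C i l"; cases "C i j") (auto simp: x_def L_def)
      with l show "\<exists>l\<in>J. l \<noteq> j \<and> C i j + x j \<le> C i l + x l" by (auto simp: L_def)
    qed
    moreover have "\<forall>j\<in>J. x j \<noteq> \<infinity>" "\<exists>j\<in>J. x j \<noteq> -\<infinity>"
      using False by (auto simp: x_def S_def)
    ultimately show ?thesis by blast
  next
    case True
    have "\<exists>k. s k j < -1" if "j \<in> J" for j
      using True that unfolding S_def bdd_below_def by (auto simp: not_le)
    from common_index[of J s "\<lambda>_. -1" 1, OF fin(2) dec this]
    obtain k where k: "k \<ge> 1" "\<And>j. j \<in> J \<Longrightarrow> s k j < -1" by blast
    \<comment> \<open>The average decrease per step over the first \<open>k\<close> steps exceeds \<open>d\<close>. Lowering the minimum below
      moves each shifted iterate to the next one less \<open>d\<close>, and the \<open>k\<close>-th shifted iterate already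
      lies below the initial one, so the minimum goes down by at least \<open>d\<close>.\<close>
    define d where "d = 1 / real k"
    have d: "d > 0" "real k * d = 1" using k by (auto simp: d_def)
    define v where "v j = Min ((\<lambda>l. s l j + real l * d) ` {..<k})" for j
    have "lowered C R J v j < v j" if j: "j \<in> J" for j
    proof -
      have step: "lowered C R J v j + d \<le> s (Suc l) j + real (Suc l) * d" if "l < k" for l
      proof -
        have "lowered C R J v j \<le> lowered C R J (s l) j + real l * d"
          using that by (intro lowered_mono_shift[OF fin j]) (auto simp: v_def)
        then show ?thesis by (simp add: s_Suc algebra_simps)
      qed
      have "lowered C R J v j + d \<le> s l j + real l * d" if "l < k" for l
      proof (cases l)
        case 0
        have "lowered C R J v j + d \<le> s k j + real k * d" using step[of "k - 1"] k(1) by simp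
        also have "\<dots> < 0" using k(2)[OF j] d by simp
        finally show ?thesis using 0 by (simp add: s_def)
      next
        case (Suc l')
        then show ?thesis using step[of l'] that by simp
      qed
      then have "lowered C R J v j + d \<le> v j"
        unfolding v_def[of j] using k(1) by (subst Min_ge_iff) (auto simp: lessThan_empty_iff)
      with d show ?thesis by simp
    qed
    then have "\<forall>j\<in>J. \<exists>i\<in>R. C i j \<noteq> -\<infinity> \<and>
      (\<forall>l\<in>J. l \<noteq> j \<longrightarrow> C i l + ereal (v l) < C i j + ereal (v j))"
      using dominating_scaling[OF fin, of C v] C by blast
    then show ?thesis by blast
  qed
qed

section \<open>Nonsingular square matrices\<close>

lemma trop_perm_weight_finite:
  assumes "\<And>i. i < dim_row B \<Longrightarrow> B $$ (i, \<sigma> i) \<noteq> \<infinity>" "\<And>i. i < dim_row B \<Longrightarrow> B $$ (i, \<sigma> i) \<noteq> -\<infinity>"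
  shows "trop_perm_weight B \<sigma> = ereal (\<Sum>i<dim_row B. real_of_ereal (B $$ (i, \<sigma> i)))"
proof -
  have "B $$ (i, \<sigma> i) = ereal (real_of_ereal (B $$ (i, \<sigma> i)))" if "i < dim_row B" for i
    using assms[OF that] by (cases "B $$ (i, \<sigma> i)") simp_all
  then have "trop_perm_weight B \<sigma> = (\<Sum>i<dim_row B. ereal (real_of_ereal (B $$ (i, \<sigma> i))))"
    unfolding trop_perm_weight_def by (intro sum.cong) auto
  then show ?thesis by simp
qed

lemma trop_perm_weight_MInfty:
  assumes "\<And>i. i < dim_row B \<Longrightarrow> B $$ (i, \<sigma> i) \<noteq> \<infinity>" "i < dim_row B" "B $$ (i, \<sigma> i) = -\<infinity>"
  shows "trop_perm_weight B \<sigma> = -\<infinity>"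
proof -
  have "(\<Sum>i\<in>{..<dim_row B} - {i}. B $$ (i, \<sigma> i)) \<noteq> \<infinity>"
    using assms(1) by (auto simp: sum_Pinfty)
  then show ?thesis
    unfolding trop_perm_weight_def using assms(2,3) by (subst sum.remove[of _ i]) auto
qed

text \<open>
  Adding \<open>v j\<close> to each column \<open>j\<close> changes the weights of all permutations by the same constant.
  Afterwards \<open>\<rho>\<close> picks the strict maximum of each row, so every other permutation has a smaller weight.
\<close>
lemma nonsingular_if_dominating:
  assumes B: "B \<in> carrier_mat k k" and entries: "\<And>i j. i < k \<Longrightarrow> j < k \<Longrightarrow> B $$ (i, j) \<noteq> \<infinity>"
    and \<rho>: "\<rho> permutes {..<k}" and finite_diag: "\<And>i. i < k \<Longrightarrow> B $$ (i, \<rho> i) \<noteq> -\<infinity>"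
    and dom: "\<And>i l. i < k \<Longrightarrow> l < k \<Longrightarrow> l \<noteq> \<rho> i \<Longrightarrow>
      B $$ (i, l) + ereal (v l) < B $$ (i, \<rho> i) + ereal (v (\<rho> i))"
  shows "\<not> trop_singular B"
proof -
  let ?b = "\<lambda>i j. real_of_ereal (B $$ (i, j))"
  have dim: "dim_row B = k" using B by simp
  have \<rho>k: "\<rho> i < k" if "i < k" for i using permutes_in_image[OF \<rho>, of i] that by simp
  have w\<rho>: "trop_perm_weight B \<rho> = ereal (\<Sum>i<k. ?b i (\<rho> i))"
    using trop_perm_weight_finite[of B \<rho>] dim entries finite_diag \<rho>k by simp
  have "trop_perm_weight B \<tau> < trop_perm_weight B \<rho>" if \<tau>: "\<tau> permutes {..<k}" "\<tau> \<noteq> \<rho>" for \<tau>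
  proof -
    have \<tau>k: "\<tau> i < k" if "i < k" for i using permutes_in_image[OF \<tau>(1), of i] that by simp
    show ?thesis
    proof (cases "\<exists>i<k. B $$ (i, \<tau> i) = -\<infinity>")
      case True
      then have "trop_perm_weight B \<tau> = -\<infinity>"
        using trop_perm_weight_MInfty[of B \<tau>] dim entries \<tau>k by auto
      then show ?thesis by (simp add: w\<rho>)
    next
      case False
      then have w\<tau>: "trop_perm_weight B \<tau> = ereal (\<Sum>i<k. ?b i (\<tau> i))"
        using trop_perm_weight_finite[of B \<tau>] dim entries \<tau>k by auto
      have lt: "?b i (\<tau> i) + v (\<tau> i) < ?b i (\<rho> i) + v (\<rho> i)" if "i < k" "\<tau> i \<noteq> \<rho> i" for i
        using dom[OF that(1) \<tau>k that(2)] that(1) False finite_diag[OF that(1)]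
          entries[OF that(1) \<tau>k[OF that(1)]] entries[OF that(1) \<rho>k[OF that(1)]]
        by (cases "B $$ (i, \<tau> i)"; cases "B $$ (i, \<rho> i)") auto
      obtain a where a: "a < k" "\<tau> a \<noteq> \<rho> a"
        using \<tau> \<rho> by (metis ext lessThan_iff permutes_not_in)
      have "(\<Sum>i<k. ?b i (\<tau> i) + v (\<tau> i)) < (\<Sum>i<k. ?b i (\<rho> i) + v (\<rho> i))"
      proof (rule sum_strict_mono_ex1)
        show "\<forall>i\<in>{..<k}. ?b i (\<tau> i) + v (\<tau> i) \<le> ?b i (\<rho> i) + v (\<rho> i)"
          using lt by (metis lessThan_iff less_imp_le order_refl)
        show "\<exists>i\<in>{..<k}. ?b i (\<tau> i) + v (\<tau> i) < ?b i (\<rho> i) + v (\<rho> i)"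
          using lt a by blast
      qed simp
      moreover have "(\<Sum>i<k. v (\<tau> i)) = (\<Sum>i<k. v (\<rho> i))"
        using sum.permute[OF \<tau>(1), of v] sum.permute[OF \<rho>, of v] by (simp add: o_def)
      ultimately show ?thesis by (simp add: w\<tau> w\<rho> sum.distrib)
    qed
  qed
  moreover have "trop_perm_weight B \<rho> \<noteq> -\<infinity>" by (simp add: w\<rho>)
  ultimately show ?thesis
    unfolding trop_singular_iff dim using \<rho> by (meson not_le)
qed

text \<open>
  Iterating the image of \<open>S\<close> under \<open>f\<close> reaches a set that \<open>f\<close> maps onto itself. Such a set is a
  union of cycles of \<open>f\<close>, along which a permutation can be modified.
\<close>
lemma exists_invariant_bij_subset:
  assumes "finite S" "S \<noteq> {}" "f ` S \<subseteq> S"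
  shows "\<exists>T\<subseteq>S. T \<noteq> {} \<and> bij_betw f T T"
  using assms
proof (induction S rule: finite_psubset_induct)
  case (psubset S)
  show ?case
  proof (cases "f ` S = S")
    case True
    then show ?thesis
      using psubset.hyps psubset.prems eq_card_imp_inj_on[of S f] unfolding bij_betw_def by auto
  next
    case False
    with psubset.prems have "f ` S \<subset> S" by blast
    moreover have "f ` f ` S \<subseteq> f ` S" using psubset.prems by (intro image_mono)
    moreover have "f ` S \<noteq> {}" using psubset.prems by simp
    ultimately obtain T where T: "T \<subseteq> f ` S" "T \<noteq> {}" "bij_betw f T T"
      using psubset.IH[of "f ` S"] by metis
    have "T \<subseteq> S" using T(1) psubset.prems(2) by (rule subset_trans)
    with T show ?thesis by metis
  qed
qed

lemma ereal_sum_le_sum_finite: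
  fixes a b c d :: ereal
  assumes "a \<noteq> \<infinity>" "a \<noteq> -\<infinity>" "b \<noteq> \<infinity>" "b \<noteq> -\<infinity>" "c \<noteq> \<infinity>" "d \<noteq> \<infinity>"
    and "a + b \<le> c + d"
  shows "c \<noteq> -\<infinity>" "d \<noteq> -\<infinity>"
    "real_of_ereal a + real_of_ereal b \<le> real_of_ereal c + real_of_ereal d"
proof -
  obtain p q where pq: "a = ereal p" "b = ereal q" using assms by (metis ereal_cases)
  then show "c \<noteq> -\<infinity>" "d \<noteq> -\<infinity>" using assms by (cases c; cases d; simp)+
  then obtain r s where rs: "c = ereal r" "d = ereal s" using assms by (metis ereal_cases)
  then show "real_of_ereal a + real_of_ereal b \<le> real_of_ereal c + real_of_ereal d"
    using assms(7) pq by simp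
qed

lemma singular_if_balanced:
  assumes B: "B \<in> carrier_mat k k" and entries: "\<And>i j. i < k \<Longrightarrow> j < k \<Longrightarrow> B $$ (i, j) \<noteq> \<infinity>"
    and x: "\<And>j. j < k \<Longrightarrow> x j \<noteq> \<infinity>" "\<exists>j<k. x j \<noteq> -\<infinity>"
    and bal: "balanced (\<lambda>i j. B $$ (i, j)) {..<k} {..<k} x"
  shows "trop_singular B"
  unfolding trop_singular_iff
proof (intro allI impI)
  fix \<sigma> assume \<sigma>': "\<sigma> permutes {..<dim_row B}" and fin: "trop_perm_weight B \<sigma> \<noteq> -\<infinity>"
  let ?b = "\<lambda>i j. real_of_ereal (B $$ (i, j))"
  let ?x = "\<lambda>j. real_of_ereal (x j)"
  have dim: "dim_row B = k" using B by simp
  have \<sigma>: "\<sigma> permutes {..<k}" using \<sigma>' dim by simp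
  have \<sigma>k: "\<sigma> i < k" if "i < k" for i using permutes_in_image[OF \<sigma>, of i] that by simp
  have fin_\<sigma>: "B $$ (i, \<sigma> i) \<noteq> -\<infinity>" if "i < k" for i
    using trop_perm_weight_MInfty[of B \<sigma> i] that fin entries \<sigma>k dim by auto
  define S where "S = {j. j < k \<and> x j \<noteq> -\<infinity>}"
  have S: "finite S" "S \<noteq> {}" using x(2) by (auto simp: S_def)
  \<comment> \<open>The quantified row \<open>i\<close> is the one that \<open>\<sigma>\<close> matches with \<open>j\<close>. Its entry in column \<open>j\<close> is finite, so
    the dependence provides a competitor, which is finite and thus lies in the support as well.\<close>
  have "\<exists>l\<in>S. l \<noteq> j \<and> (\<forall>i<k. \<sigma> i = j \<longrightarrow> B $$ (i, l) \<noteq> -\<infinity> \<and> ?b i j + ?x j \<le> ?b i l + ?x l)"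
    if j: "j \<in> S" for j
  proof -
    obtain i where i: "i < k" "\<sigma> i = j"
      using permutes_image[OF \<sigma>] j unfolding S_def by (metis (no_types, lifting) imageE lessThan_iff mem_Collect_eq)
    have "B $$ (i, j) + x j \<noteq> -\<infinity>" using fin_\<sigma>[OF i(1)] i j by (auto simp: S_def)
    then obtain l where l: "l < k" "l \<noteq> j" "B $$ (i, j) + x j \<le> B $$ (i, l) + x l"
      using bal i(1) \<sigma>k[OF i(1)] unfolding balanced_def i(2) by blast
    have jk: "j < k" using \<sigma>k[OF i(1)] i(2) by simp
    have "l \<in> S" "B $$ (i, l) \<noteq> -\<infinity>" "?b i j + ?x j \<le> ?b i l + ?x l"
      using ereal_sum_le_sum_finite[OF _ _ _ _ _ _ l(3)] l(1) fin_\<sigma>[OF i(1)] i j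
        entries[OF i(1) jk] entries[OF i(1) l(1)] x(1)[OF jk] x(1)[OF l(1)]
      by (simp_all add: S_def)
    moreover have "i' = i" if "i' < k" "\<sigma> i' = j" for i'
      using permutes_inj[OF \<sigma>] that i by (metis injD)
    ultimately show ?thesis using l(2) by metis
  qed
  then obtain f where f: "\<And>j. j \<in> S \<Longrightarrow> f j \<in> S" "\<And>j. j \<in> S \<Longrightarrow> f j \<noteq> j"
    "\<And>i. i < k \<Longrightarrow> \<sigma> i \<in> S \<Longrightarrow> B $$ (i, f (\<sigma> i)) \<noteq> -\<infinity>"
    "\<And>i. i < k \<Longrightarrow> \<sigma> i \<in> S \<Longrightarrow> ?b i (\<sigma> i) + ?x (\<sigma> i) \<le> ?b i (f (\<sigma> i)) + ?x (f (\<sigma> i))"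
    by metis
  obtain T where T: "T \<subseteq> S" "T \<noteq> {}" "bij_betw f T T"
    using exists_invariant_bij_subset[OF S, of f] f(1) by blast
  define g where "g j = (if j \<in> T then f j else j)" for j
  have Tk: "T \<subseteq> {..<k}" using T(1) by (auto simp: S_def)
  have "bij_betw g T T" using T(3) by (simp add: g_def cong: bij_betw_cong)
  then have "g permutes T" by (intro bij_imp_permutes) (auto simp: g_def)
  then have g: "g permutes {..<k}" using Tk by (rule permutes_subset)
  have \<tau>: "g \<circ> \<sigma> permutes {..<k}" by (rule permutes_compose[OF \<sigma> g])
  have neq: "g \<circ> \<sigma> \<noteq> \<sigma>"
  proof
    assume eq: "g \<circ> \<sigma> = \<sigma>"
    obtain j where j: "j \<in> T" using T(2) by blast
    obtain i where "\<sigma> i = j" using permutes_surj[OF \<sigma>] by (metis surjD)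
    then have "g j = j" using eq by (metis comp_apply)
    then show False using f(2) j T(1) by (auto simp: g_def)
  qed
  have \<tau>k: "g (\<sigma> i) < k" if "i < k" for i using permutes_in_image[OF \<tau>, of i] that by simp
  have fin_\<tau>: "B $$ (i, g (\<sigma> i)) \<noteq> -\<infinity>" if "i < k" for i
    using f(3)[OF that] T(1) fin_\<sigma>[OF that] by (auto simp: g_def)
  have "(\<Sum>i<k. ?b i (\<sigma> i) + ?x (\<sigma> i)) \<le> (\<Sum>i<k. ?b i (g (\<sigma> i)) + ?x (g (\<sigma> i)))"
    using f(4) T(1) by (intro sum_mono) (auto simp: g_def)
  moreover have "(\<Sum>i<k. ?x (\<sigma> i)) = (\<Sum>i<k. ?x (g (\<sigma> i)))"
    using sum.permute[OF \<sigma>, of ?x] sum.permute[OF \<tau>, of ?x] by (simp add: o_def)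
  ultimately have "(\<Sum>i<k. ?b i (\<sigma> i)) \<le> (\<Sum>i<k. ?b i ((g \<circ> \<sigma>) i))" by (simp add: sum.distrib)
  then have "trop_perm_weight B \<sigma> \<le> trop_perm_weight B (g \<circ> \<sigma>)"
    using trop_perm_weight_finite[of B \<sigma>] trop_perm_weight_finite[of B "g \<circ> \<sigma>"]
      dim entries \<sigma>k \<tau>k fin_\<sigma> fin_\<tau> by simp
  with \<tau> neq dim show "\<exists>\<tau>. \<tau> permutes {..<dim_row B} \<and> \<tau> \<noteq> \<sigma> \<and>
      trop_perm_weight B \<sigma> \<le> trop_perm_weight B \<tau>" by auto
qed

section \<open>Independent columns and nonsingular submatrices\<close>

lemma
  assumes "A \<in> carrier_mat m n" "I \<subseteq> {..<m}" "J \<subseteq> {..<n}"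
  shows submatrix_dims: "submatrix A I J \<in> carrier_mat (card I) (card J)"
    and submatrix_entry: "a < card I \<Longrightarrow> b < card J \<Longrightarrow> submatrix A I J $$ (a, b) = A $$ (pick I a, pick J b)"
proof -
  have I: "{i. i < dim_row A \<and> i \<in> I} = I"
    using assms(2) unfolding carrier_matD(1)[OF assms(1)] by blast
  have J: "{j. j < dim_col A \<and> j \<in> J} = J"
    using assms(3) unfolding carrier_matD(2)[OF assms(1)] by blast
  show "submatrix A I J \<in> carrier_mat (card I) (card J)"
    by (rule carrier_matI) (simp_all only: dim_submatrix I J)
  show "a < card I \<Longrightarrow> b < card J \<Longrightarrow> submatrix A I J $$ (a, b) = A $$ (pick I a, pick J b)"
    using submatrix_index[of a A I b J] unfolding I J by simp
qed

lemma pick_lessThan: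
  assumes "i < n"
  shows "pick {..<n} i = i"
proof -
  have "{a. a < n \<and> a \<in> UNIV} = {..<n}" by auto
  then show ?thesis using pick_reduce_set[of i n UNIV] assms by (simp only: pick_UNIV card_lessThan)
qed

lemma bij_betw_pick: "finite I \<Longrightarrow> bij_betw (pick I) {..<card I} I"
proof -
  assume I: "finite I"
  have inj: "inj_on (pick I) {..<card I}"
    using pick_mono_le[of _ I] by (intro inj_onI) (metis lessThan_iff less_irrefl nat_neq_iff)
  moreover have "pick I ` {..<card I} \<subseteq> I" by (auto simp: pick_in_set_le)
  ultimately show ?thesis
    unfolding bij_betw_def using card_image[OF inj] I by (simp add: card_subset_eq)
qed

lemma cols_dependent_submatrix_rows:
  assumes A: "A \<in> carrier_mat m n" and IJ: "I \<subseteq> {..<m}" "J \<subseteq> {..<n}"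
    and dep: "trop_cols_dependent (submatrix A {..<m} J)"
  shows "trop_cols_dependent (submatrix A I J)"
proof -
  have dims: "submatrix A {..<m} J \<in> carrier_mat m (card J)" "submatrix A I J \<in> carrier_mat (card I) (card J)"
    using submatrix_dims[OF A _ IJ(2), of "{..<m}"] submatrix_dims[OF A IJ] by auto
  have row: "submatrix A I J $$ (a, b) = submatrix A {..<m} J $$ (pick I a, b)" and less: "pick I a < m"
    if "a < card I" "b < card J" for a b
  proof -
    show less: "pick I a < m" using pick_in_set_le[OF that(1)] IJ by auto
    show "submatrix A I J $$ (a, b) = submatrix A {..<m} J $$ (pick I a, b)"
      using submatrix_entry[OF A IJ that] submatrix_entry[OF A subset_refl IJ(2), of "pick I a" b] that less
      by (simp add: pick_lessThan)
  qed
  from dep obtain x where x: "\<forall>j<card J. x j \<noteq> \<infinity>" "\<exists>j<card J. x j \<noteq> -\<infinity>"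
    and bal: "balanced (\<lambda>i j. submatrix A {..<m} J $$ (i, j)) {..<m} {..<card J} x"
    unfolding trop_cols_dependent_iff using dims by auto
  have "balanced (\<lambda>i j. submatrix A I J $$ (i, j)) {..<card I} {..<card J} x"
    unfolding balanced_def
  proof (intro ballI impI)
    fix a b assume a: "a \<in> {..<card I}" and b: "b \<in> {..<card J}"
      and nz: "submatrix A I J $$ (a, b) + x b \<noteq> -\<infinity>"
    then obtain l where "l < card J" "l \<noteq> b" "submatrix A {..<m} J $$ (pick I a, b) + x b
        \<le> submatrix A {..<m} J $$ (pick I a, l) + x l"
      using bal row[of a b] less[of a b] unfolding balanced_def by (metis lessThan_iff)
    then show "\<exists>l\<in>{..<card J}. l \<noteq> b \<and> submatrix A I J $$ (a, b) + x b \<le> submatrix A I J $$ (a, l) + x l"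
      using row[of a] a b by auto
  qed
  with x show ?thesis unfolding trop_cols_dependent_iff using dims by auto
qed

lemma cols_independent_if_nonsingular:
  assumes A: "A \<in> carrier_mat m n" and entries: "\<And>i j. i < m \<Longrightarrow> j < n \<Longrightarrow> A $$ (i, j) \<noteq> \<infinity>"
    and IJ: "I \<subseteq> {..<m}" "J \<subseteq> {..<n}" "card I = card J"
    and nonsing: "\<not> trop_singular (submatrix A I J)"
  shows "\<not> trop_cols_dependent (submatrix A {..<m} J)"
proof
  assume "trop_cols_dependent (submatrix A {..<m} J)"
  then have dep: "trop_cols_dependent (submatrix A I J)"
    by (rule cols_dependent_submatrix_rows[OF A IJ(1,2)])
  have dims: "submatrix A I J \<in> carrier_mat (card J) (card J)"
    using submatrix_dims[OF A IJ(1,2)] IJ(3) by simp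
  have fin: "submatrix A I J $$ (a, b) \<noteq> \<infinity>" if "a < card J" "b < card J" for a b
  proof -
    have "a < card I" using that IJ(3) by simp
    then have "pick I a < m" "pick J b < n"
      using pick_in_set_le[of a I] pick_in_set_le[of b J] that(2) IJ(1,2) by auto
    then show ?thesis using submatrix_entry[OF A IJ(1,2) \<open>a < card I\<close> that(2)] entries by simp
  qed
  from dep obtain x where "\<forall>j<card J. x j \<noteq> \<infinity>" "\<exists>j<card J. x j \<noteq> -\<infinity>"
    "balanced (\<lambda>i j. submatrix A I J $$ (i, j)) {..<card J} {..<card J} x"
    unfolding trop_cols_dependent_iff carrier_matD[OF dims] by blast
  then have "trop_singular (submatrix A I J)"
    using singular_if_balanced[OF dims, of x] fin by blast
  with nonsing show False by contradiction
qed

text \<open>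
  By independence, every column is the strict maximum of some row after adding the scalars \<open>v\<close>. A
  row has only one strict maximum, so the choice \<open>s\<close> of rows is injective and selects a square
  submatrix.
\<close>
lemma nonsingular_if_cols_independent:
  assumes A: "A \<in> carrier_mat m n" and entries: "\<And>i j. i < m \<Longrightarrow> j < n \<Longrightarrow> A $$ (i, j) \<noteq> \<infinity>"
    and J: "J \<subseteq> {..<n}" and indep: "\<not> trop_cols_dependent (submatrix A {..<m} J)"
  shows "\<exists>I\<subseteq>{..<m}. card I = card J \<and> \<not> trop_singular (submatrix A I J)"
proof -
  define k where "k = card J"
  define C where "C i b = A $$ (i, pick J b)" for i b
  have sub: "submatrix A {..<m} J \<in> carrier_mat m k"
    using submatrix_dims[OF A _ J, of "{..<m}"] by (simp add: k_def)
  have sub_C: "submatrix A {..<m} J $$ (i, b) = C i b" if "i < m" "b < k" for i b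
    using submatrix_entry[OF A subset_refl J, of i b] that by (simp add: k_def C_def pick_lessThan)
  have C: "C i b \<noteq> \<infinity>" if "i < m" "b < k" for i b
    using entries[OF that(1), of "pick J b"] pick_in_set_le[of b J] that J by (auto simp: C_def k_def)
  have "balanced C {..<m} {..<k} x \<longleftrightarrow> balanced (\<lambda>i j. submatrix A {..<m} J $$ (i, j)) {..<m} {..<k} x" for x
    unfolding balanced_def using sub_C by simp
  then have "\<not> (\<exists>x. (\<forall>j\<in>{..<k}. x j \<noteq> \<infinity>) \<and> (\<exists>j\<in>{..<k}. x j \<noteq> -\<infinity>) \<and> balanced C {..<m} {..<k} x)"
    using indep unfolding trop_cols_dependent_iff carrier_matD[OF sub] by blast
  moreover have "(\<exists>x. (\<forall>j\<in>{..<k}. x j \<noteq> \<infinity>) \<and> (\<exists>j\<in>{..<k}. x j \<noteq> -\<infinity>) \<and> balanced C {..<m} {..<k} x) \<or>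
    (\<exists>v. \<forall>j\<in>{..<k}. \<exists>i\<in>{..<m}. C i j \<noteq> -\<infinity> \<and>
      (\<forall>l\<in>{..<k}. l \<noteq> j \<longrightarrow> C i l + ereal (v l) < C i j + ereal (v j)))"
    using C by (intro balanced_or_dominating) simp_all
  ultimately obtain v where "\<forall>j\<in>{..<k}. \<exists>i\<in>{..<m}. C i j \<noteq> -\<infinity> \<and>
      (\<forall>l\<in>{..<k}. l \<noteq> j \<longrightarrow> C i l + ereal (v l) < C i j + ereal (v j))" by blast
  then obtain s where s: "\<And>j. j < k \<Longrightarrow> s j < m" "\<And>j. j < k \<Longrightarrow> C (s j) j \<noteq> -\<infinity>"
    and dom: "\<And>j l. j < k \<Longrightarrow> l < k \<Longrightarrow> l \<noteq> j \<Longrightarrow> C (s j) l + ereal (v l) < C (s j) j + ereal (v j)"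
    by (metis lessThan_iff)
  have inj: "inj_on s {..<k}"
    using dom by (intro inj_onI) (metis lessThan_iff less_asym)
  define I where "I = s ` {..<k}"
  have I: "I \<subseteq> {..<m}" "card I = k" "finite I" using s(1) card_image[OF inj] by (auto simp: I_def)
  define B where "B = submatrix A I J"
  have B: "B \<in> carrier_mat k k" using submatrix_dims[OF A I(1) J] I(2) by (simp add: B_def k_def)
  have B_C: "B $$ (a, b) = C (pick I a) b" if "a < k" "b < k" for a b
    using submatrix_entry[OF A I(1) J] that I(2) by (simp add: B_def C_def k_def)
  have pick_I: "bij_betw (pick I) {..<k} I" using bij_betw_pick[OF I(3)] I(2) by simp
  \<comment> \<open>Submatrices list the selected rows in increasing order, so the optimal permutation of \<open>B\<close> is
    the inverse of \<open>s\<close>, read in this numbering.\<close>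
  define \<rho> where "\<rho> a = (if a < k then the_inv_into {..<k} s (pick I a) else a)" for a
  have "bij_betw s {..<k} I" using inj by (simp add: I_def bij_betw_def)
  then have "bij_betw (the_inv_into {..<k} s \<circ> pick I) {..<k} {..<k}"
    by (intro bij_betw_trans[OF pick_I] bij_betw_the_inv_into)
  then have "bij_betw \<rho> {..<k} {..<k}" by (subst bij_betw_cong[of _ \<rho>]) (auto simp: \<rho>_def)
  then have \<rho>: "\<rho> permutes {..<k}" by (intro bij_imp_permutes) (auto simp: \<rho>_def)
  have s\<rho>: "s (\<rho> a) = pick I a" "\<rho> a < k" if "a < k" for a
  proof -
    have "pick I a \<in> s ` {..<k}" using pick_I that unfolding I_def bij_betw_def by auto
    then show "s (\<rho> a) = pick I a" using f_the_inv_into_f[OF inj] that by (simp add: \<rho>_def)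
    show "\<rho> a < k" using permutes_in_image[OF \<rho>, of a] that by simp
  qed
  have picked: "pick I a < m" if "a < k" for a using s(1) s\<rho>[OF that] by metis
  have "\<not> trop_singular B"
  proof (rule nonsingular_if_dominating[OF B _ \<rho>, of v])
    show "B $$ (i, j) \<noteq> \<infinity>" if "i < k" "j < k" for i j using that C picked by (simp add: B_C)
    show "B $$ (i, \<rho> i) \<noteq> -\<infinity>" if "i < k" for i
      using s\<rho>[OF that] s(2)[of "\<rho> i"] that by (simp add: B_C)
    show "B $$ (i, l) + ereal (v l) < B $$ (i, \<rho> i) + ereal (v (\<rho> i))"
      if "i < k" "l < k" "l \<noteq> \<rho> i" for i l
      using s\<rho>[OF that(1)] dom[of "\<rho> i" l] that by (simp add: B_C)
  qed
  with I show ?thesis by (auto simp: B_def k_def)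
qed

lemma max_col_rank_eq_trop_rank:
  assumes A: "A \<in> carrier_mat m n" and entries: "\<And>i j. i < m \<Longrightarrow> j < n \<Longrightarrow> A $$ (i, j) \<noteq> \<infinity>"
  shows "max_col_rank A = trop_rank A"
proof -
  have "{card J | J. J \<subseteq> {..<n} \<and> \<not> trop_cols_dependent (submatrix A {..<m} J)} =
    {k. \<exists>I J. I \<subseteq> {..<m} \<and> J \<subseteq> {..<n} \<and> card I = k \<and> card J = k \<and> \<not> trop_singular (submatrix A I J)}"
    (is "?L = ?R")
  proof
    show "?L \<subseteq> ?R"
    proof
      fix k assume "k \<in> ?L"
      then obtain J where J: "J \<subseteq> {..<n}" "\<not> trop_cols_dependent (submatrix A {..<m} J)" "k = card J"
        by blast
      obtain I where "I \<subseteq> {..<m}" "card I = card J" "\<not> trop_singular (submatrix A I J)"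
        using nonsingular_if_cols_independent[OF A _ J(1,2)] entries by metis
      then show "k \<in> ?R" using J by blast
    qed
    show "?R \<subseteq> ?L"
    proof
      fix k assume "k \<in> ?R"
      then obtain I J where IJ: "I \<subseteq> {..<m}" "J \<subseteq> {..<n}" "card I = k" "card J = k"
        "\<not> trop_singular (submatrix A I J)" by blast
      have "\<not> trop_cols_dependent (submatrix A {..<m} J)"
        using cols_independent_if_nonsingular[OF A _ IJ(1,2) _ IJ(5)] entries IJ(3,4) by simp
      then show "k \<in> ?L" using IJ(2,4) by blast
    qed
  qed
  then show ?thesis unfolding max_col_rank_def trop_rank_def carrier_matD[OF A] by simp
qed

section \<open>Transposition\<close>

lemma transpose_submatrix: "transpose_mat (submatrix A I J) = submatrix (transpose_mat A) J I"
  by (rule eq_matI) (auto simp: dim_submatrix submatrix_index pick_le)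

lemma max_row_rank_eq_max_col_rank_transpose: "max_row_rank A = max_col_rank (transpose_mat A)"
  unfolding max_row_rank_def max_col_rank_def trop_rows_dependent_def transpose_submatrix by simp

lemma trop_perm_weight_transpose:
  assumes B: "B \<in> carrier_mat k k" and \<sigma>: "\<sigma> permutes {..<k}"
  shows "trop_perm_weight (transpose_mat B) \<sigma> = trop_perm_weight B (inv_into UNIV \<sigma>)"
proof -
  have "trop_perm_weight (transpose_mat B) \<sigma> = (\<Sum>i<k. B $$ (\<sigma> i, i))"
    unfolding trop_perm_weight_def using B permutes_in_image[OF \<sigma>] by (intro sum.cong) auto
  also have "\<dots> = (\<Sum>i<k. B $$ (\<sigma> i, inv_into UNIV \<sigma> (\<sigma> i)))"
    using permutes_inverses[OF \<sigma>] by simp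
  also have "\<dots> = (\<Sum>i<k. B $$ (i, inv_into UNIV \<sigma> i))"
    using sum.permute[OF \<sigma>, of "\<lambda>i. B $$ (i, inv_into UNIV \<sigma> i)"] by (simp add: o_def)
  finally show ?thesis using B by (simp add: trop_perm_weight_def)
qed

text \<open>
  Inversion of permutations preserves both weights and distinctness.
\<close>
lemma trop_singular_transposeD:
  assumes B: "B \<in> carrier_mat k k" and sing: "trop_singular B"
  shows "trop_singular (transpose_mat B)"
proof -
  have dims: "dim_row B = k" "dim_row (transpose_mat B) = k" using B by auto
  show ?thesis
    unfolding trop_singular_iff dims
  proof (intro allI impI)
    fix \<sigma> assume \<sigma>: "\<sigma> permutes {..<k}" and w: "trop_perm_weight (transpose_mat B) \<sigma> \<noteq> -\<infinity>"
    then obtain \<tau> where \<tau>: "\<tau> permutes {..<k}" "\<tau> \<noteq> inv_into UNIV \<sigma>" "trop_perm_weight B (inv_into UNIV \<sigma>) \<le> trop_perm_weight B \<tau>"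
      using sing permutes_inv[OF \<sigma>] unfolding trop_singular_iff dims trop_perm_weight_transpose[OF B \<sigma>]
      by blast
    have "inv_into UNIV \<tau> permutes {..<k}" by (rule permutes_inv[OF \<tau>(1)])
    moreover have "inv_into UNIV \<tau> \<noteq> \<sigma>" using \<tau> by (metis permutes_inv_inv)
    moreover have "trop_perm_weight (transpose_mat B) \<sigma> \<le> trop_perm_weight (transpose_mat B) (inv_into UNIV \<tau>)"
      using \<tau> trop_perm_weight_transpose[OF B] \<sigma> calculation(1) by (simp add: permutes_inv_inv)
    ultimately show "\<exists>\<tau>. \<tau> permutes {..<k} \<and> \<tau> \<noteq> \<sigma> \<and>
        trop_perm_weight (transpose_mat B) \<sigma> \<le> trop_perm_weight (transpose_mat B) \<tau>" by blast
  qed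
qed

lemma trop_rank_transpose:
  assumes A: "A \<in> carrier_mat m n"
  shows "trop_rank (transpose_mat A) = trop_rank A"
proof -
  have sing: "trop_singular (submatrix (transpose_mat A) J I) \<longleftrightarrow> trop_singular (submatrix A I J)"
    if "I \<subseteq> {..<m}" "J \<subseteq> {..<n}" "card I = card J" for I J
  proof -
    have "submatrix A I J \<in> carrier_mat (card J) (card J)" using submatrix_dims[OF A that(1,2)] that(3) by simp
    then show ?thesis
      using trop_singular_transposeD[of "submatrix A I J"] trop_singular_transposeD[of "transpose_mat (submatrix A I J)"]
      by (metis transpose_submatrix transpose_carrier_mat transpose_transpose)
  qed
  have "{k. \<exists>I J. I \<subseteq> {..<n} \<and> J \<subseteq> {..<m} \<and> card I = k \<and> card J = k \<and> \<not> trop_singular (submatrix (transpose_mat A) I J)} =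
    {k. \<exists>I J. I \<subseteq> {..<m} \<and> J \<subseteq> {..<n} \<and> card I = k \<and> card J = k \<and> \<not> trop_singular (submatrix A I J)}"
    using sing by (intro Collect_cong) metis
  then show ?thesis using A unfolding trop_rank_def by simp
qed

theorem corollary4p16:
  fixes A :: "ereal mat" and m n :: nat
  assumes "A \<in> carrier_mat m n"
    and "\<And>i j. i < m \<Longrightarrow> j < n \<Longrightarrow> A $$ (i, j) \<in> trop_scalars"
  shows "max_row_rank A = max_col_rank A \<and> max_col_rank A = trop_rank A"
proof
  have entries: "A $$ (i, j) \<noteq> \<infinity>" if "i < m" "j < n" for i j
    using assms(2)[OF that] by (simp add: trop_scalars_def)
  show col: "max_col_rank A = trop_rank A" by (rule max_col_rank_eq_trop_rank[OF assms(1) entries])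
  have "max_row_rank A = max_col_rank (transpose_mat A)"
    by (rule max_row_rank_eq_max_col_rank_transpose)
  also have "\<dots> = trop_rank (transpose_mat A)"
    using assms(1) entries by (intro max_col_rank_eq_trop_rank[of _ n m]) auto
  also have "\<dots> = trop_rank A" by (rule trop_rank_transpose[OF assms(1)])
  finally show "max_row_rank A = max_col_rank A" using col by simp
qed

end
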